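(* Let $(\gamma_t,\delta_t,R_t)$, with $\gamma_t=\sum_{i\ge0}\gamma_it^i$, $\delta_t=\sum_{i\ge0}\delta_it^i$, $R_t=\sum_{i\ge0}R_it^i$, be a formal $1$-parameter deformation of the $\lambda$-weighted Rota-Baxter LieDer pair $(L,\delta,R)$. Then $(\gamma_1,\delta_1,R_1)\in\mathfrak{C}^2_{\mathrm{RBLieDer}}(L,L)$ is a $2$-cocycle in the cohomology of $(L,\delta,R)$ with coefficients in the adjoint representation, i.e. $\mathfrak D_{\mathrm{RBLieDer}}((\gamma_1,\delta_1),R_1)=0$.
   Context: Fix a field $\mathbb{K}$ and $\lambda\in\mathbb{K}$. A $\lambda$-weighted Rota-Baxter LieDer pair $(L,\delta,R)$ is a Lie algebra $(L,[\cdot,\cdot])$ over $\mathbb K$, a derivation $\delta$, and a linear map $R:L\to L$ with $[Rx,Ry]=R([Rx,y]+[x,Ry]+\lambda[x,y])$ and $R\circ\delta=\delta\circ R$. Formal deformation. A formal $1$-parameter deformation of $(L,\delta,R)$ is a triple of formal power series $\gamma_t=\sum_{i\ge0}\gamma_it^i$ with $\gamma_i\in\mathrm{Hom}(\wedge^2L,L)$, $\gamma_0=[\cdot,\cdot]$; $\delta_t=\sum_{i\ge0}\delta_it^i$ with $\delta_i\in\mathrm{Hom}(L,L)$, $\delta_0=\delta$; $R_t=\sum_{i\ge0}R_it^i$ with $R_i\in\mathrm{Hom}(L,L)$, $R_0=R$; such that on $L[[t]]$ (extending $\mathbb K[[t]]$-(bi)linearly) $\gamma_t$ is a Lie bracket,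 $\delta_t$ is a derivation of $\gamma_t$, and $R_t$ is a $\lambda$-weighted Rota-Baxter operator for $\gamma_t$; that is, for all $x,y,z\in L$: $\gamma_t(x,\gamma_t(y,z))+\gamma_t(y,\gamma_t(z,x))+\gamma_t(z,\gamma_t(x,y))=0$, $\gamma_t(R_tx,R_ty)=R_t(\gamma_t(R_tx,y)+\gamma_t(x,R_ty)+\lambda\gamma_t(x,y))$, $\delta_t(\gamma_t(x,y))=\gamma_t(\delta_tx,y)+\gamma_t(x,\delta_ty)$. Cohomology with coefficients in the adjoint representation. Put $[x,y]_R=[Rx,y]+[x,Ry]+\lambda[x,y]$ and $\widetilde\rho(x)(y)=[Rx,y]-R[x,y]$. On $C^n=\mathrm{Hom}(\wedge^nL,L)$ define $(\mathrm{d}f)(x_1,\dots,x_{n+1})=\sum_{i}(-1)^{i+n}[x_i,f(x_1,\dots,\hat{x_i},\dots,x_{n+1})]+\sum_{i<j}(-1)^{i+j+n+1}f([x_i,x_j],x_1,\dots,\hat{x_i},\dots,\hat{x_j},\dots,x_{n+1})$; $\mathrm{d}_R$ by the same formula with $[x_i,f(\cdots)]$ replaced by $\widetilde\rho(x_i)f(\cdots)$ and $[x_i,x_j]$ replaced by $[x_i,x_j]_R$; $\partial f=\sum_{i=1}^nf\circ(\mathbf 1\otimes\cdots\otimes\delta\otimes\cdots\otimes\mathbf 1)-\delta\circ f$ ($\delta$ in the $i$-th place); and $\Phi(f)(x_1,\dots,x_n)=f(Rx_1,\dots,Rx_n)-\sum_{k=0}^{n-1}\lambda^{n-k-1}\sum_{i_1<\cdots<i_k}R\big(f(x_1,\dots,R(x_{i_1}),\dots,R(x_{i_k}),\dots,x_n)\big)$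 ($R$ applied exactly to the arguments in positions $i_1,\dots,i_k$). The cochain spaces are $\mathfrak C^0_{\mathrm{RBLieDer}}(L,L)=0$, $\mathfrak C^1_{\mathrm{RBLieDer}}(L,L)=\mathrm{Hom}(L,L)$, $\mathfrak C^n_{\mathrm{RBLieDer}}(L,L)=(C^n\oplus C^{n-1})\oplus C^{n-1}$ for $n\ge2$, with differential $\mathfrak D_{\mathrm{RBLieDer}}(f)=(\mathrm{d}f,-\partial f,-\Phi f)$ for $n=1$ and $\mathfrak D_{\mathrm{RBLieDer}}((f,g),h)=(\mathrm{d}f,\mathrm{d}g+(-1)^n\partial f,-\mathrm{d}_Rh-\Phi f)$ for $n\ge2$. *)

theory Defs
  imports
    "HOL-Library.Function_Algebras"
    "HOL-Library.Product_Plus"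
    "HOL-Computational_Algebra.Formal_Power_Series"
begin

unbundle fps_syntax

section \<open>Rota-Baxter LieDer pairs\<close>

text \<open>
  The underlying space \<open>L\<close> of a Lie algebra is the type \<open>'v\<close>, a vector space over the field \<open>'k\<close> (of any
  characteristic) via the scalar multiplication \<open>scale\<close>.
\<close>

definition alternating_bilinear ::
    "('k::field \<Rightarrow> 'v::ab_group_add \<Rightarrow> 'v) \<Rightarrow> ('v \<Rightarrow> 'v \<Rightarrow> 'v) \<Rightarrow> bool" where
  "alternating_bilinear scale b \<longleftrightarrow>
     (\<forall>x. Vector_Spaces.linear scale scale (\<lambda>y. b x y)) \<and>
     (\<forall>y. Vector_Spaces.linear scale scale (\<lambda>x. b x y)) \<and>
     (\<forall>x. b x x = 0)"

locale lie_algebra = vector_space scale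
  for scale :: "'k::field \<Rightarrow> 'v::ab_group_add \<Rightarrow> 'v" +
  fixes br :: "'v \<Rightarrow> 'v \<Rightarrow> 'v"
  assumes alternating_bilinear_br: "alternating_bilinear scale br"
    and jacobi: "br x (br y z) + br y (br z x) + br z (br x y) = 0"

locale rota_baxter_lieder_pair = lie_algebra scale br
  for scale :: "'k::field \<Rightarrow> 'v::ab_group_add \<Rightarrow> 'v" and br :: "'v \<Rightarrow> 'v \<Rightarrow> 'v" +
  fixes lam :: 'k and \<delta> R :: "'v \<Rightarrow> 'v"
  assumes linear_\<delta>: "Vector_Spaces.linear scale scale \<delta>"
    and derivation: "\<delta> (br x y) = br (\<delta> x) y + br x (\<delta> y)"
    and linear_R: "Vector_Spaces.linear scale scale R"
    and rota_baxter: "br (R x) (R y) = R (br (R x) y + br x (R y) + scale lam (br x y))"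
    and commute: "R \<circ> \<delta> = \<delta> \<circ> R"

section \<open>Formal deformations\<close>

text \<open>
  \<open>L[[t]]\<close> is the type \<open>'v fps\<close>, with \<open>fps_const\<close> as the inclusion of \<open>L\<close>; the next two functions are
  the \<open>K[[t]]\<close>-linear and \<open>K[[t]]\<close>-bilinear extensions to \<open>L[[t]]\<close> of power series whose coefficients
  are linear, respectively bilinear, maps.
\<close>

definition fps_lin_ext :: "('v::ab_group_add \<Rightarrow> 'v) fps \<Rightarrow> 'v fps \<Rightarrow> 'v fps" where
  "fps_lin_ext F a = Abs_fps (\<lambda>n. \<Sum>i\<le>n. (F $ i) (a $ (n - i)))"

definition fps_bilin_ext ::
    "('v::ab_group_add \<Rightarrow> 'v \<Rightarrow> 'v) fps \<Rightarrow> 'v fps \<Rightarrow> 'v fps \<Rightarrow> 'v fps" where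
  "fps_bilin_ext B a b =
     Abs_fps (\<lambda>n. \<Sum>i\<le>n. \<Sum>j\<le>n - i. (B $ i) (a $ j) (b $ (n - i - j)))"

definition fps_scale ::
    "('k::field \<Rightarrow> 'v::ab_group_add \<Rightarrow> 'v) \<Rightarrow> 'k \<Rightarrow> 'v fps \<Rightarrow> 'v fps" where
  "fps_scale scale c a = Abs_fps (\<lambda>n. scale c (a $ n))"

text \<open>
  Only \<open>\<delta>\<close> and \<open>R\<close> are assumed to commute; a deformation does not require this of \<open>\<delta>\<^sub>t\<close> and \<open>R\<^sub>t\<close>. It is
  enough to impose the identities on elements of \<open>L\<close>, both sides being \<open>K[[t]]\<close>-multilinear.
\<close>

definition formal_deformation ::
    "('k::field \<Rightarrow> 'v::ab_group_add \<Rightarrow> 'v) \<Rightarrow> ('v \<Rightarrow> 'v \<Rightarrow> 'v) \<Rightarrow> 'k \<Rightarrow> ('v \<Rightarrow> 'v) \<Rightarrow> ('v \<Rightarrow> 'v) \<Rightarrow>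
     ('v \<Rightarrow> 'v \<Rightarrow> 'v) fps \<Rightarrow> ('v \<Rightarrow> 'v) fps \<Rightarrow> ('v \<Rightarrow> 'v) fps \<Rightarrow> bool" where
  "formal_deformation scale br lam \<delta> R \<gamma>\<^sub>t \<delta>\<^sub>t R\<^sub>t \<longleftrightarrow>
     (\<forall>i. alternating_bilinear scale (\<gamma>\<^sub>t $ i)) \<and>
     (\<forall>i. Vector_Spaces.linear scale scale (\<delta>\<^sub>t $ i)) \<and>
     (\<forall>i. Vector_Spaces.linear scale scale (R\<^sub>t $ i)) \<and>
     \<gamma>\<^sub>t $ 0 = br \<and> \<delta>\<^sub>t $ 0 = \<delta> \<and> R\<^sub>t $ 0 = R \<and>
     (let G = fps_bilin_ext \<gamma>\<^sub>t; D = fps_lin_ext \<delta>\<^sub>t; P = fps_lin_ext R\<^sub>t in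
       \<forall>u v w. let x = fps_const u; y = fps_const v; z = fps_const w in
         G x (G y z) + G y (G z x) + G z (G x y) = 0 \<and>
         G (P x) (P y) = P (G (P x) y + G x (P y) + fps_scale scale lam (G x y)) \<and>
         D (G x y) = G (D x) y + G x (D y))"

section \<open>The cochain complex with adjoint coefficients\<close>

text \<open>
  \<open>cochains scale n\<close> is \<open>Hom(\<And>\<^sup>n L, L)\<close>: alternating \<open>n\<close>-linear maps, represented as functions on lists
  that take the value \<open>0\<close> on lists whose length is not \<open>n\<close>, so that equality of cochains is equality of
  functions. List positions count from \<open>0\<close>, so the position \<open>i\<close> below is \<open>i + 1\<close> in the usual
  numbering \<open>x\<^sub>1, x\<^sub>2, \<dots>\<close> of the arguments; the signs are written with the shifted positions.
\<close>

definition cochains ::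
    "('k::field \<Rightarrow> 'v::ab_group_add \<Rightarrow> 'v) \<Rightarrow> nat \<Rightarrow> ('v list \<Rightarrow> 'v) set" where
  "cochains scale n =
     {f. (\<forall>xs. length xs \<noteq> n \<longrightarrow> f xs = 0) \<and>
         (\<forall>xs i. length xs = n \<and> i < n \<longrightarrow>
            Vector_Spaces.linear scale scale (\<lambda>v. f (xs[i := v]))) \<and>
         (\<forall>xs i j. length xs = n \<and> i < j \<and> j < n \<and> xs ! i = xs ! j \<longrightarrow> f xs = 0)}"

definition cochain_of_linear :: "('v::ab_group_add \<Rightarrow> 'v) \<Rightarrow> 'v list \<Rightarrow> 'v" where
  "cochain_of_linear F xs = (if length xs = 1 then F (xs ! 0) else 0)"

definition cochain_of_bilinear :: "('v::ab_group_add \<Rightarrow> 'v \<Rightarrow> 'v) \<Rightarrow> 'v list \<Rightarrow> 'v" where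
  "cochain_of_bilinear B xs = (if length xs = 2 then B (xs ! 0) (xs ! 1) else 0)"

text \<open>
  The formula common to \<open>d\<close> and \<open>d\<^sub>R\<close>, for an action \<open>\<rho>\<close> and a bracket \<open>b\<close>; \<open>nths xs (- I)\<close> is \<open>xs\<close> with
  the entries at the positions in \<open>I\<close> omitted.
\<close>

definition ce_diff ::
    "('k::field \<Rightarrow> 'v::ab_group_add \<Rightarrow> 'v) \<Rightarrow> ('v \<Rightarrow> 'v \<Rightarrow> 'v) \<Rightarrow> ('v \<Rightarrow> 'v \<Rightarrow> 'v) \<Rightarrow>
     nat \<Rightarrow> ('v list \<Rightarrow> 'v) \<Rightarrow> 'v list \<Rightarrow> 'v" where
  "ce_diff scale \<rho> b n f xs =
     (if length xs = n + 1 then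
        (\<Sum>i<n + 1. scale ((-1) ^ ((i + 1) + n)) (\<rho> (xs ! i) (f (nths xs (- {i}))))) +
        (\<Sum>(i, j) \<in> {(i, j). i < j \<and> j < n + 1}.
           scale ((-1) ^ ((i + 1) + (j + 1) + n + 1))
             (f (b (xs ! i) (xs ! j) # nths xs (- {i, j}))))
      else 0)"

definition br_R ::
    "('k::field \<Rightarrow> 'v::ab_group_add \<Rightarrow> 'v) \<Rightarrow> ('v \<Rightarrow> 'v \<Rightarrow> 'v) \<Rightarrow> 'k \<Rightarrow> ('v \<Rightarrow> 'v) \<Rightarrow> 'v \<Rightarrow> 'v \<Rightarrow> 'v" where
  "br_R scale br lam R x y = br (R x) y + br x (R y) + scale lam (br x y)"

definition rho_R :: "('v::ab_group_add \<Rightarrow> 'v \<Rightarrow> 'v) \<Rightarrow> ('v \<Rightarrow> 'v) \<Rightarrow> 'v \<Rightarrow> 'v \<Rightarrow> 'v" where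
  "rho_R br R x y = br (R x) y - R (br x y)"

definition partial_der ::
    "('v::ab_group_add \<Rightarrow> 'v) \<Rightarrow> nat \<Rightarrow> ('v list \<Rightarrow> 'v) \<Rightarrow> 'v list \<Rightarrow> 'v" where
  "partial_der \<delta> n f xs =
     (if length xs = n then (\<Sum>i<n. f (xs[i := \<delta> (xs ! i)])) - \<delta> (f xs) else 0)"

definition apply_at :: "('v \<Rightarrow> 'v) \<Rightarrow> nat set \<Rightarrow> 'v list \<Rightarrow> 'v list" where
  "apply_at R I xs = map (\<lambda>i. if i \<in> I then R (xs ! i) else xs ! i) [0..<length xs]"

definition Phi ::
    "('k::field \<Rightarrow> 'v::ab_group_add \<Rightarrow> 'v) \<Rightarrow> 'k \<Rightarrow> ('v \<Rightarrow> 'v) \<Rightarrow>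
     nat \<Rightarrow> ('v list \<Rightarrow> 'v) \<Rightarrow> 'v list \<Rightarrow> 'v" where
  "Phi scale lam R n f xs =
     (if length xs = n then
        f (map R xs) -
        (\<Sum>k<n. scale (lam ^ (n - k - 1))
           (\<Sum>I \<in> {I. I \<subseteq> {..<n} \<and> card I = k}. R (f (apply_at R I xs))))
      else 0)"

type_synonym 'v triple = "(('v list \<Rightarrow> 'v) \<times> ('v list \<Rightarrow> 'v)) \<times> ('v list \<Rightarrow> 'v)"

text \<open>
  All degrees live in one type of triples; in degree \<open>1\<close> the space \<open>Hom(L, L)\<close> is embedded as the
  first component.
\<close>

definition rbld_cochains ::
    "('k::field \<Rightarrow> 'v::ab_group_add \<Rightarrow> 'v) \<Rightarrow> nat \<Rightarrow> 'v triple set" where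
  "rbld_cochains scale n =
     (if n = 0 then {0}
      else if n = 1 then (cochains scale 1 \<times> {0}) \<times> {0}
      else (cochains scale n \<times> cochains scale (n - 1)) \<times> cochains scale (n - 1))"

definition rbld_diff ::
    "('k::field \<Rightarrow> 'v::ab_group_add \<Rightarrow> 'v) \<Rightarrow> ('v \<Rightarrow> 'v \<Rightarrow> 'v) \<Rightarrow> 'k \<Rightarrow> ('v \<Rightarrow> 'v) \<Rightarrow> ('v \<Rightarrow> 'v) \<Rightarrow>
     nat \<Rightarrow> 'v triple \<Rightarrow> 'v triple" where
  "rbld_diff scale br lam \<delta> R n = (\<lambda>((f, g), h).
     let d = ce_diff scale br br;
         dR = ce_diff scale (rho_R br R) (br_R scale br lam R);
         pd = partial_der \<delta>;
         \<Phi> = Phi scale lam R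
     in
       if n = 0 then 0
       else if n = 1 then ((d 1 f, - pd 1 f), - \<Phi> 1 f)
       else ((d n f, \<lambda>xs. d (n - 1) g xs + scale ((-1) ^ n) (pd n f xs)),
             - dR (n - 1) h - \<Phi> n f))"

definition rbld_cocycles ::
    "('k::field \<Rightarrow> 'v::ab_group_add \<Rightarrow> 'v) \<Rightarrow> ('v \<Rightarrow> 'v \<Rightarrow> 'v) \<Rightarrow> 'k \<Rightarrow> ('v \<Rightarrow> 'v) \<Rightarrow> ('v \<Rightarrow> 'v) \<Rightarrow>
     nat \<Rightarrow> 'v triple set" where
  "rbld_cocycles scale br lam \<delta> R n =
     {c \<in> rbld_cochains scale n. rbld_diff scale br lam \<delta> R n c = 0}"

end

theory Submission imports Defs begin

text \<open>
  The coefficients of \<open>t\<close> in the Jacobi, derivation and Rota-Baxter identities of the deformation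
  are the vanishing of the three components of \<open>\<D>((\<gamma>\<^sub>1, \<delta>\<^sub>1), R\<^sub>1)\<close>, after reordering arguments by
  antisymmetry of the bracket and of \<open>\<gamma>\<^sub>1\<close>.
\<close>

lemma fps_lin_ext_nth_0: "fps_lin_ext F a $ 0 = (F $ 0) (a $ 0)"
  by (simp add: fps_lin_ext_def)

lemma fps_lin_ext_nth_1: "fps_lin_ext F a $ Suc 0 = (F $ 0) (a $ Suc 0) + (F $ Suc 0) (a $ 0)"
  by (simp add: fps_lin_ext_def)

lemma fps_bilin_ext_nth_0: "fps_bilin_ext B a b $ 0 = (B $ 0) (a $ 0) (b $ 0)"
  by (simp add: fps_bilin_ext_def)

lemma fps_bilin_ext_nth_1:
  "fps_bilin_ext B a b $ Suc 0 =
     (B $ 0) (a $ 0) (b $ Suc 0) + (B $ 0) (a $ Suc 0) (b $ 0) + (B $ Suc 0) (a $ 0) (b $ 0)"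
  by (simp add: fps_bilin_ext_def)

text \<open>Coefficients at 0 and 1 form a closed system: the coefficient at t of any nested
  expression depends only on these two coefficients of its parts. The index is \<open>Suc 0\<close>
  because simp rewrites \<open>1\<close> to it.\<close>

lemmas fps_ext_nths = fps_lin_ext_nth_0 fps_lin_ext_nth_1 fps_bilin_ext_nth_0 fps_bilin_ext_nth_1

lemma linear_add: "Vector_Spaces.linear s1 s2 f \<Longrightarrow> f (x + y) = f x + f y"
  by (rule module_hom.add[OF Vector_Spaces.linear.axioms(3)])

lemma linear_zero: "Vector_Spaces.linear s1 s2 f \<Longrightarrow> f 0 = 0"
  by (rule module_hom.zero[OF Vector_Spaces.linear.axioms(3)])

lemma linear_neg: "Vector_Spaces.linear s1 s2 f \<Longrightarrow> f (- x) = - f x"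
  by (rule module_hom.neg[OF Vector_Spaces.linear.axioms(3)])

lemma linear_scale: "Vector_Spaces.linear s1 s2 f \<Longrightarrow> f (s1 c x) = s2 c (f x)"
  by (rule module_hom.scale[OF Vector_Spaces.linear.axioms(3)])

context
  fixes scale :: "'k::field \<Rightarrow> 'v::ab_group_add \<Rightarrow> 'v" and b :: "'v \<Rightarrow> 'v \<Rightarrow> 'v"
  assumes alt: "alternating_bilinear scale b"
begin

lemma alternating_bilinear_linear:
  "Vector_Spaces.linear scale scale (b x)" "Vector_Spaces.linear scale scale (\<lambda>x. b x y)"
  and alternating_bilinear_refl: "b x x = 0"
  using alt by (auto simp: alternating_bilinear_def)

lemma alternating_bilinear_zero: "b 0 y = 0" "b x 0 = 0"
  using alternating_bilinear_linear linear_zero by blast+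

lemma alternating_bilinear_add: "b (x + x') y = b x y + b x' y" "b x (y + y') = b x y + b x y'"
  using alternating_bilinear_linear linear_add by blast+

lemma alternating_bilinear_minus: "b x (- y) = - b x y"
  using alternating_bilinear_linear linear_neg by blast

text \<open>Polarization of \<open>b x x = 0\<close>, valid in every characteristic. It serves both
  for the bracket and for \<open>\<gamma>\<^sub>t $ 1\<close>.\<close>

lemma alternating_bilinear_anticomm: "b x y = - b y x"
proof -
  have "0 = b (x + y) (x + y)"
    by (simp only: alternating_bilinear_refl)
  \<comment> \<open>Expansion must come first; with \<open>alternating_bilinear_refl\<close>
    present, the whole term would collapse to 0 again.\<close>
  also have "\<dots> = b x y + b y x"
    by (simp only: alternating_bilinear_add) (simp add: alternating_bilinear_refl add.commute)
  finally show ?thesis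
    by (simp add: eq_neg_iff_add_eq_0)
qed

lemma cochain_of_bilinear_in_cochains: "cochain_of_bilinear b \<in> cochains scale 2"
proof -
  have "Vector_Spaces.linear scale scale (\<lambda>v. cochain_of_bilinear b (xs[i := v]))"
    if "length xs = 2" "i < 2" for xs i
  proof -
    from that(2) consider "i = 0" | "i = 1" by linarith
    then show ?thesis
      using that(1) alternating_bilinear_linear by cases (simp_all add: cochain_of_bilinear_def)
  qed
  moreover have "cochain_of_bilinear b xs = 0"
    if "length xs = 2 \<and> i < j \<and> j < 2 \<and> xs ! i = xs ! j" for xs i j
  proof -
    from that have "i = 0" "j = 1" by linarith+
    with that show ?thesis
      by (simp add: cochain_of_bilinear_def alternating_bilinear_refl)
  qed
  ultimately show ?thesis
    by (auto simp: cochains_def cochain_of_bilinear_def)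
qed

end

lemma cochain_of_linear_in_cochains:
  "Vector_Spaces.linear scale scale f \<Longrightarrow> cochain_of_linear f \<in> cochains scale 1"
  by (auto simp: cochains_def cochain_of_linear_def)

context vector_space
begin

text \<open>\<open>\<rho>\<close> and \<open>b\<close> stay arbitrary so that the formula covers d
  on the derivation part and d_R on the Rota-Baxter part.\<close>

lemma ce_diff_cochain_of_linear:
  "ce_diff scale \<rho> b (Suc 0) (cochain_of_linear f) xs =
     (if length xs = 2
      then \<rho> (xs ! 0) (f (xs ! 1)) - \<rho> (xs ! 1) (f (xs ! 0)) - f (b (xs ! 0) (xs ! 1)) else 0)"
proof (cases "length xs = 2")
  case True
  then obtain x y where "xs = [x, y]"
    by (auto simp: length_Suc_conv numeral_2_eq_2)
  moreover have "{(i, j). i < j \<and> j < Suc (Suc 0)} = {(0, 1)}"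
    by auto
  ultimately show ?thesis
    by (simp add: ce_diff_def nths_Cons cochain_of_linear_def lessThan_Suc)
qed (simp add: ce_diff_def)

text \<open>The sign convention differs from the usual Chevalley-Eilenberg one by (-1)^(n+1), hence
  the leading minus in degree 2.\<close>

lemma ce_diff_cochain_of_bilinear:
  "ce_diff scale \<rho> b 2 (cochain_of_bilinear f) xs =
     (if length xs = 3
      then let x = xs ! 0; y = xs ! 1; z = xs ! 2 in
        - \<rho> x (f y z) + \<rho> y (f x z) - \<rho> z (f x y) + f (b x y) z - f (b x z) y + f (b y z) x
      else 0)"
proof (cases "length xs = 3")
  case True
  then obtain x y z where "xs = [x, y, z]"
    by (auto simp: length_Suc_conv numeral_3_eq_3)
  moreover have "{(i, j). i < j \<and> j < Suc (Suc (Suc 0))} = {(0, 1), (0, 2), (1, 2)}"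
    by auto
  ultimately show ?thesis
    by (simp add: ce_diff_def nths_Cons cochain_of_bilinear_def lessThan_Suc eval_nat_numeral)
qed (simp add: ce_diff_def)

lemma partial_der_cochain_of_bilinear:
  "partial_der \<delta> 2 (cochain_of_bilinear f) xs =
     (if length xs = 2
      then f (\<delta> (xs ! 0)) (xs ! 1) + f (xs ! 0) (\<delta> (xs ! 1)) - \<delta> (f (xs ! 0) (xs ! 1)) else 0)"
  by (simp add: partial_der_def cochain_of_bilinear_def eval_nat_numeral lessThan_Suc)

lemma Phi_cochain_of_bilinear:
  "Phi scale lam R 2 (cochain_of_bilinear f) xs =
     (if length xs = 2
      then let x = xs ! 0; y = xs ! 1 in
        f (R x) (R y) - scale lam (R (f x y)) - R (f (R x) y) - R (f x (R y))
      else 0)"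
proof (cases "length xs = 2")
  case True
  then obtain x y where "xs = [x, y]"
    by (auto simp: length_Suc_conv numeral_2_eq_2)
  \<comment> \<open>The outer sum has k = 0 (the empty set, weight \<open>lam\<close>) and k = 1
    (two singletons, weight 1). As \<open>card\<close> is 0 on infinite sets too, finiteness of I
    enters here.\<close>
  moreover have "{I. I \<subseteq> {..<2::nat} \<and> card I = 0} = {{}}"
    by (auto dest: finite_subset)
  moreover have "{I. I \<subseteq> {..<2::nat} \<and> card I = 1} = {{0}, {1}}"
    by (auto simp: card_1_singleton_iff)
  ultimately show ?thesis
    by (simp add: Phi_def apply_at_def cochain_of_bilinear_def eval_nat_numeral lessThan_Suc)
qed (simp add: Phi_def)

end

theorem theorem4p1:
  fixes scale :: "'k::field \<Rightarrow> 'v::ab_group_add \<Rightarrow> 'v"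
    and br :: "'v \<Rightarrow> 'v \<Rightarrow> 'v" and lam :: 'k and \<delta> R :: "'v \<Rightarrow> 'v"
    and \<gamma>\<^sub>t :: "('v \<Rightarrow> 'v \<Rightarrow> 'v) fps" and \<delta>\<^sub>t R\<^sub>t :: "('v \<Rightarrow> 'v) fps"
  assumes "rota_baxter_lieder_pair scale br lam \<delta> R"
    and "formal_deformation scale br lam \<delta> R \<gamma>\<^sub>t \<delta>\<^sub>t R\<^sub>t"
  shows "((cochain_of_bilinear (\<gamma>\<^sub>t $ 1), cochain_of_linear (\<delta>\<^sub>t $ 1)), cochain_of_linear (R\<^sub>t $ 1))
           \<in> rbld_cocycles scale br lam \<delta> R 2"
proof -
  interpret rota_baxter_lieder_pair scale br lam \<delta> R
    by (fact assms(1))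
  define f g h where "f = \<gamma>\<^sub>t $ 1" and "g = \<delta>\<^sub>t $ 1" and "h = R\<^sub>t $ 1"
  have alt_f: "alternating_bilinear scale f" and lin_g: "Vector_Spaces.linear scale scale g"
    and lin_h: "Vector_Spaces.linear scale scale h"
    and coeff_0: "\<gamma>\<^sub>t $ 0 = br" "\<delta>\<^sub>t $ 0 = \<delta>" "R\<^sub>t $ 0 = R"
    using assms(2) by (auto simp: formal_deformation_def Let_def f_def g_def h_def)
  have coeff_1: "\<gamma>\<^sub>t $ Suc 0 = f" "\<delta>\<^sub>t $ Suc 0 = g" "R\<^sub>t $ Suc 0 = h"
    by (simp_all add: f_def g_def h_def)
  \<comment> \<open>A constant series has zero coefficient at t, so the expansion below produces
    terms with \<open>br\<close>, \<open>\<delta>\<close> or \<open>R\<close> applied to 0.\<close>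
  note [simp] = alternating_bilinear_zero[OF alternating_bilinear_br]
    linear_zero[OF linear_\<delta>] linear_zero[OF linear_R]
  note simps = fps_ext_nths fps_scale_def coeff_0 coeff_1
  \<comment> \<open>Order and grouping of the summands are those in which the coefficient rules
    produce them.\<close>
  have jacobi_1: "br u (f v w) + f u (br v w) + (br v (f w u) + f v (br w u))
      + (br w (f u v) + f w (br u v)) = 0"
    and rota_baxter_1: "br (R u) (h v) + br (h u) (R v) + f (R u) (R v) =
      R (br (h u) v + f (R u) v + (br u (h v) + f u (R v)) + scale lam (f u v))
      + h (br (R u) v + br u (R v) + scale lam (br u v))"
    and derivation_1: "\<delta> (f u v) + g (br u v) = br (g u) v + f (\<delta> u) v + (br u (g v) + f u (\<delta> v))"
    for u v w
  proof -
    let ?G = "fps_bilin_ext \<gamma>\<^sub>t" and ?D = "fps_lin_ext \<delta>\<^sub>t" and ?P = "fps_lin_ext R\<^sub>t"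
    let ?u = "fps_const u" and ?v = "fps_const v" and ?w = "fps_const w"
    have "?G ?u (?G ?v ?w) + ?G ?v (?G ?w ?u) + ?G ?w (?G ?u ?v) = 0"
      and "?G (?P ?u) (?P ?v) = ?P (?G (?P ?u) ?v + ?G ?u (?P ?v) + fps_scale scale lam (?G ?u ?v))"
      and "?D (?G ?u ?v) = ?G (?D ?u) ?v + ?G ?u (?D ?v)"
      using assms(2) unfolding formal_deformation_def Let_def by blast+
    from this[THEN arg_cong, of "\<lambda>a. a $ Suc 0"]
    show "br u (f v w) + f u (br v w) + (br v (f w u) + f v (br w u))
      + (br w (f u v) + f w (br u v)) = 0"
      and "br (R u) (h v) + br (h u) (R v) + f (R u) (R v) =
      R (br (h u) v + f (R u) v + (br u (h v) + f u (R v)) + scale lam (f u v))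
      + h (br (R u) v + br u (R v) + scale lam (br u v))"
      and "\<delta> (f u v) + g (br u v) = br (g u) v + f (\<delta> u) v + (br u (g v) + f u (\<delta> v))"
      by (simp_all add: simps)
  qed
  note anticomm_br = alternating_bilinear_anticomm[OF alternating_bilinear_br]
  note anticomm_f = alternating_bilinear_anticomm[OF alt_f]
  have df: "ce_diff scale br br 2 (cochain_of_bilinear f) xs = 0" for xs
  proof -
    have "- br x (f y z) + br y (f x z) - br z (f x y) + f (br x y) z - f (br x z) y + f (br y z) x = 0"
      for x y z
    proof -
      \<comment> \<open>These swaps restore the cyclic order of the Jacobi identity: one sign here,
        two cancelling signs in the next equation. The cochain expression then is minus the left
        side of \<open>jacobi_1\<close>.\<close>
      have "br y (f x z) = - br y (f z x)"
        by (subst anticomm_f) (rule alternating_bilinear_minus[OF alternating_bilinear_br])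
      moreover have "f (br x z) y = f y (br z x)"
        by (subst anticomm_f, subst anticomm_br) (simp add: alternating_bilinear_minus[OF alt_f])
      ultimately have "- br x (f y z) + br y (f x z) - br z (f x y) + f (br x y) z - f (br x z) y + f (br y z) x =
          - (br x (f y z) + f x (br y z) + (br y (f z x) + f y (br z x)) + (br z (f x y) + f z (br x y)))"
        \<comment> \<open>Anticommutativity is instantiated to fix the direction of each
          swap.\<close>
        by (simp only: anticomm_f[of "br x y" z] anticomm_f[of "br y z" x]) (simp add: algebra_simps)
      then show ?thesis
        by (simp only: jacobi_1 minus_zero)
    qed
    then show ?thesis
      by (simp add: ce_diff_cochain_of_bilinear Let_def)
  qed
  \<comment> \<open>The sign (-1)^n is + for n = 2. The sum is the right side minus the left side of
    \<open>derivation_1\<close>, once \<open>br y (g x)\<close> is turned into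
    \<open>- br (g x) y\<close>.\<close>
  have dg: "ce_diff scale br br 1 (cochain_of_linear g) xs
      + partial_der \<delta> 2 (cochain_of_bilinear f) xs = 0" for xs
    using derivation_1[of "xs ! 0" "xs ! 1"] anticomm_br[of "xs ! 1" "g (xs ! 0)"]
    by (simp add: ce_diff_cochain_of_linear partial_der_cochain_of_bilinear algebra_simps)
  \<comment> \<open>Likewise right side minus left side of \<open>rota_baxter_1\<close>. The two
    terms of \<open>rho_R br R y (h x)\<close> each need a swap, and linearity of \<open>R\<close>
    carries the sign and \<open>lam\<close> through.\<close>
  have dh: "- ce_diff scale (rho_R br R) (br_R scale br lam R) 1 (cochain_of_linear h) xs
      - Phi scale lam R 2 (cochain_of_bilinear f) xs = 0" for xs
    using rota_baxter_1[of "xs ! 0" "xs ! 1"] anticomm_br[of "xs ! 1" "h (xs ! 0)"]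
      anticomm_br[of "R (xs ! 1)" "h (xs ! 0)"]
    by (simp add: ce_diff_cochain_of_linear Phi_cochain_of_bilinear Let_def rho_R_def br_R_def
        linear_add[OF linear_R] linear_neg[OF linear_R] linear_scale[OF linear_R] algebra_simps)
  have "((cochain_of_bilinear f, cochain_of_linear g), cochain_of_linear h) \<in> rbld_cochains scale 2"
    using cochain_of_bilinear_in_cochains[OF alt_f] cochain_of_linear_in_cochains[OF lin_g]
      cochain_of_linear_in_cochains[OF lin_h]
    by (simp add: rbld_cochains_def)
  moreover have "rbld_diff scale br lam \<delta> R 2
      ((cochain_of_bilinear f, cochain_of_linear g), cochain_of_linear h) = 0"
    using df dg dh
    by (simp add: rbld_diff_def Let_def zero_prod_def fun_eq_iff)
  ultimately show ?thesis
    by (simp add: rbld_cocycles_def f_def g_def h_def)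
qed

end
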